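(* The function $x\mapsto \frac{x}{\ln(1+x)}$ is a Bernstein function on $(0,\infty)$.
   Context: A function $f$ is completely monotonic on an interval $I$ if it has derivatives of all orders on $I$ and $(-1)^{k}f^{(k)}(t)\ge0$ for all $t\in I$ and all integers $k\ge0$. A function $f:I\to[0,\infty)$ on an interval $I\subseteq\mathbb{R}$ is a Bernstein function on $I$ if it has derivatives of all orders on $I$ and $f'$ is completely monotonic on $I$. (The function $x/\ln(1+x)$ is the generating function of the Bernoulli numbers of the second kind.) *)

theory Defs
  imports "HOL-Analysis.Analysis"
begin

text \<open>
  Derivatives are taken relative to \<^term>\<open>I\<close>, so that they are one-sided at the end points of
  \<^term>\<open>I\<close> that belong to \<^term>\<open>I\<close>. On an open \<^term>\<open>I\<close> this is the usual derivative. Only the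
  values at points of \<^term>\<open>I\<close> are meaningful.
\<close>

definition deriv_on :: "real set \<Rightarrow> (real \<Rightarrow> real) \<Rightarrow> real \<Rightarrow> real" where
  "deriv_on I f = (\<lambda>t. vector_derivative f (at t within I))"

definition smooth_on :: "real set \<Rightarrow> (real \<Rightarrow> real) \<Rightarrow> bool" where
  "smooth_on I f \<longleftrightarrow> (\<forall>k. (deriv_on I ^^ k) f differentiable_on I)"

text \<open>
  Intervals are required to be nondegenerate (which makes derivatives relative to them unique);
  they may be open, closed, half-open, bounded or unbounded.
\<close>

definition completely_monotonic_on :: "real set \<Rightarrow> (real \<Rightarrow> real) \<Rightarrow> bool" where
  "completely_monotonic_on I f \<longleftrightarrow>
     is_interval I \<and> interior I \<noteq> {} \<and> smooth_on I f \<and>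
     (\<forall>k. \<forall>t\<in>I. (-1) ^ k * (deriv_on I ^^ k) f t \<ge> 0)"

definition bernstein_on :: "real set \<Rightarrow> (real \<Rightarrow> real) \<Rightarrow> bool" where
  "bernstein_on I f \<longleftrightarrow>
     is_interval I \<and> interior I \<noteq> {} \<and> (\<forall>t\<in>I. f t \<ge> 0) \<and> smooth_on I f \<and>
     completely_monotonic_on I (deriv_on I f)"

end

theory Submission
  imports Defs
begin

text \<open>
  For \<^term>\<open>x > (0::real)\<close>, integrating in \<^term>\<open>t\<close> over \<open>[0, 1]\<close> gives
  \<open>x / ln (1 + x) = \<integral> (1 + x) powr t dt\<close>. Differentiating \<open>n \<ge> 1\<close> times under the integral sign
  multiplies the integrand by \<open>t (t - 1) \<dots> (t - n + 1)\<close>, whose sign on \<open>[0, 1]\<close>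
  is \<open>(-1) ^ (n - 1)\<close>.
\<close>

text \<open>A derivative relative to \<open>I\<close> depends only on values on \<open>I\<close>, so
  each iterate may be replaced by \<open>F n\<close> before the next differentiation. Nothing is
  claimed outside \<open>I\<close>, where \<open>deriv_on\<close> carries no information.\<close>

lemma deriv_on_funpow_eq:
  fixes F :: "nat \<Rightarrow> real \<Rightarrow> real"
  assumes "open I"
    and f: "\<And>x. x \<in> I \<Longrightarrow> f x = F 0 x"
    and F: "\<And>n x. x \<in> I \<Longrightarrow> (F n has_real_derivative F (Suc n) x) (at x within I)"
    and "x \<in> I"
  shows "(deriv_on I ^^ n) f x = F n x"
  using \<open>x \<in> I\<close>
proof (induction n arbitrary: x)
  case 0
  then show ?case by (simp add: f)
next
  case (Suc n)
  have "((deriv_on I ^^ n) f has_vector_derivative F (Suc n) x) (at x within I)"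
  proof (rule has_vector_derivative_transform[OF Suc.prems])
    show "(F n has_vector_derivative F (Suc n) x) (at x within I)"
      using F[OF Suc.prems] by (simp add: has_real_derivative_iff_has_vector_derivative)
  qed (use Suc.IH in simp)
  \<comment> \<open>A nontrivial filter makes the derivative unique, so
    \<open>vector_derivative\<close> selects exactly \<open>F (Suc n) x\<close>.\<close>
  moreover have "at x within I \<noteq> bot"
    by (simp only: at_within_open[OF Suc.prems \<open>open I\<close>] at_neq_bot not_False_eq_True)
  ultimately show ?case
    by (simp add: deriv_on_def[of I "(deriv_on I ^^ n) f"] vector_derivative_within)
qed

lemma smooth_on_if_derivatives:
  fixes F :: "nat \<Rightarrow> real \<Rightarrow> real"
  assumes "open I"
    and "\<And>x. x \<in> I \<Longrightarrow> f x = F 0 x"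
    and F: "\<And>n x. x \<in> I \<Longrightarrow> (F n has_real_derivative F (Suc n) x) (at x within I)"
  shows "smooth_on I f"
proof -
  have "(deriv_on I ^^ n) f differentiable (at x within I)" if "x \<in> I" for n x
  proof -
    have "F n differentiable (at x within I)"
      using F[OF that] by (auto simp: real_differentiable_def)
    then show ?thesis
      using that deriv_on_funpow_eq[OF assms]
      by (auto simp: differentiable_def intro: has_derivative_transform)
  qed
  then show ?thesis
    by (simp add: smooth_on_def differentiable_on_def)
qed

lemma bernstein_onI:
  fixes F :: "nat \<Rightarrow> real \<Rightarrow> real"
  assumes "open I" "is_interval I" "I \<noteq> {}"
    and f: "\<And>x. x \<in> I \<Longrightarrow> f x = F 0 x"
    and F: "\<And>n x. x \<in> I \<Longrightarrow> (F n has_real_derivative F (Suc n) x) (at x within I)"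
    and nonneg: "\<And>x. x \<in> I \<Longrightarrow> F 0 x \<ge> 0"
    and sign: "\<And>n x. x \<in> I \<Longrightarrow> (-1) ^ n * F (Suc n) x \<ge> 0"
  shows "bernstein_on I f"
proof -
  have f': "deriv_on I f x = F (Suc 0) x" if "x \<in> I" for x
    using deriv_on_funpow_eq[where n = 1, OF \<open>open I\<close> f F that] by simp
  have "smooth_on I f"
    using \<open>open I\<close> f F by (rule smooth_on_if_derivatives)
  \<comment> \<open>The shifted sequence \<open>F (Suc n)\<close> is a tower of derivatives for the
    first derivative of \<open>f\<close>.\<close>
  moreover have "smooth_on I (deriv_on I f)"
    using \<open>open I\<close> f' F by (rule smooth_on_if_derivatives[where F = "\<lambda>n. F (Suc n)"])
  moreover have "(deriv_on I ^^ n) (deriv_on I f) x = F (Suc n) x" if "x \<in> I" for n x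
    using \<open>open I\<close> f' F that by (rule deriv_on_funpow_eq[where F = "\<lambda>n. F (Suc n)"])
  ultimately show ?thesis
    using assms by (simp add: bernstein_on_def completely_monotonic_on_def interior_open)
qed

definition powr_integral_deriv :: "nat \<Rightarrow> real \<Rightarrow> real" where
  "powr_integral_deriv n x =
     integral {0..1} (\<lambda>t. (\<Prod>i<n. t - real i) * (1 + x) powr (t - real n))"

text \<open>Joint continuity in \<open>x\<close> and \<open>t\<close> is what the Leibniz rule
  demands of the differentiated integrand; it holds since the base \<open>1 + x\<close> stays
  positive.\<close>

lemma continuous_on_powr_integrand:
  "continuous_on ({0<..} \<times> {0..1})
     (\<lambda>(x, t). (\<Prod>i<n. t - real i) * (1 + x) powr (t - real n))"
  unfolding case_prod_unfold by (intro continuous_intros) auto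

lemma powr_integrand_integrable:
  assumes "(x::real) > 0"
  shows "(\<lambda>t. (\<Prod>i<n. t - real i) * (1 + x) powr (t - real n)) integrable_on {0..1}"
  using assms by (intro integrable_continuous_interval continuous_intros) auto

lemma has_real_derivative_powr_integral_deriv:
  assumes "x \<in> {0<..}"
  shows "(powr_integral_deriv n has_real_derivative powr_integral_deriv (Suc n) x)
           (at x within {0<..})"
proof -
  let ?f = "\<lambda>n x t. (\<Prod>i<n. t - real i) * (1 + x) powr (t - real n)"
  have "((\<lambda>y. integral (cbox 0 1) (?f n y)) has_field_derivative integral (cbox 0 1) (?f (Suc n) x))
          (at x within {0<..})"
  proof (rule leibniz_rule_field_derivative)
    \<comment> \<open>Differentiating the power brings down \<open>t - real n\<close>, which is
      precisely the next factor of the product, and lowers the exponent by one.\<close>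
    show "((\<lambda>y. ?f n y t) has_field_derivative ?f (Suc n) y t) (at y within {0<..})"
      if "y \<in> {0<..}" for y t :: real
      using that by (auto intro!: derivative_eq_intros simp: algebra_simps)
  qed (use assms powr_integrand_integrable continuous_on_powr_integrand[of "Suc n"] in auto)
  then show ?thesis
    by (simp add: powr_integral_deriv_def[abs_def])
qed

lemma powr_integral_deriv_0:
  assumes "x > 0"
  shows "powr_integral_deriv 0 x = x / ln (1 + x)"
proof -
  \<comment> \<open>An antiderivative in \<open>t\<close> is
    \<open>(1 + x) powr t / ln (1 + x)\<close>, with nonzero denominator because
    \<open>x > 0\<close>; its increment over the unit interval has numerator
    \<open>(1 + x) - 1 = x\<close>.\<close>
  have "((\<lambda>t. (1 + x) powr t) has_integral
          (1 + x) powr 1 / ln (1 + x) - (1 + x) powr 0 / ln (1 + x)) {0..1}"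
    using assms
    by (intro fundamental_theorem_of_calculus)
       (auto simp: powr_def simp flip: has_real_derivative_iff_has_vector_derivative
         intro!: derivative_eq_intros)
  then show ?thesis
    using assms
    by (simp add: powr_integral_deriv_def integral_unique flip: diff_divide_distrib)
qed

text \<open>The factor for \<open>i = 0\<close> is \<open>t\<close>, which is nonnegative; each of
  the other \<open>n\<close> factors is nonpositive and absorbs one factor
  \<open>-1\<close>.\<close>

lemma falling_factorial_sign:
  fixes t :: real
  assumes "t \<in> {0..1}"
  shows "(-1) ^ n * (\<Prod>i<Suc n. t - real i) \<ge> 0"
proof -
  have "(\<Prod>i<n. real (Suc i) - t) = (\<Prod>i<n. (-1) * (t - real (Suc i)))"
    by simp
  also have "\<dots> = (-1) ^ n * (\<Prod>i<n. t - real (Suc i))"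
    by (simp only: prod.distrib prod_constant card_lessThan)
  finally have "(-1) ^ n * (\<Prod>i<Suc n. t - real i) = t * (\<Prod>i<n. real (Suc i) - t)"
    by (simp only: prod.lessThan_Suc_shift) simp
  also have "\<dots> \<ge> 0"
    using assms by (intro mult_nonneg_nonneg prod_nonneg) auto
  finally show ?thesis .
qed

lemma powr_integral_deriv_sign:
  assumes "x > 0"
  shows "(-1) ^ n * powr_integral_deriv (Suc n) x \<ge> 0"
proof -
  \<comment> \<open>With the sign moved under the integral, the integrand is nonnegative pointwise
    by \<open>falling_factorial_sign\<close>.\<close>
  have "0 \<le> integral {0..1}
     (\<lambda>t. (-1) ^ n * ((\<Prod>i<Suc n. t - real i) * (1 + x) powr (t - real (Suc n))))"
    using powr_integrand_integrable[OF assms, of "Suc n"] falling_factorial_sign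
    by (intro integral_nonneg integrable_on_mult_right)
       (auto simp flip: mult.assoc simp del: prod.lessThan_Suc)
  then show ?thesis
    by (simp add: powr_integral_deriv_def)
qed

theorem theorem6p1:
  shows "bernstein_on {0<..} (\<lambda>x::real. x / ln (1 + x))"
proof (rule bernstein_onI)
  show "x / ln (1 + x) = powr_integral_deriv 0 x" if "x \<in> {0<..}" for x :: real
    using that by (simp add: powr_integral_deriv_0)
  show "powr_integral_deriv 0 x \<ge> 0" if "x \<in> {0<..}" for x
    using that by (simp add: powr_integral_deriv_0)
  show "(-1) ^ n * powr_integral_deriv (Suc n) x \<ge> 0" if "x \<in> {0<..}" for n x
    using that by (simp add: powr_integral_deriv_sign)
qed (simp_all only: has_real_derivative_powr_integral_deriv, simp_all)

end
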